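(* Let $b\ge 1$ be an integer, let $w_1,\dots,w_b$ be positive integers, let $p_1,\dots,p_b\in(0,1)$, let $\vec c=(c_1,\dots,c_b)$ be a vector of positive real numbers, and let $\varepsilon>0$. Consider the optimization problem over real vectors $\vec n=(n_1,\dots,n_b)\in\mathbb{R}^b$: $$\text{minimize } \vec c\cdot\vec n\quad\text{subject to}\quad n_i\ge w_i \text{ for all } i=1,\dots,b \quad\text{and}\quad \prod_{i=1}^b D(n_i;w_i,p_i)\ge\varepsilon .$$ Then every local minimizer $\vec n^{*}$ of this problem attains the global minimal value; that is, if $\vec n^*$ is feasible and there is a neighborhood $U$ of $\vec n^*$ in $\mathbb{R}^b$ such that $\vec c\cdot\vec n^*\le\vec c\cdot\vec n$ for all feasible $\vec n\in U$, then $\vec c\cdot\vec n^*\le\vec c\cdot\vec n$ for all feasible $\vec n$.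
   Context: For a positive integer $w$, real $n\ge w$ and $p\in(0,1)$, $$D(n;w,p) := I_p(w,\,n-w+1),\qquad I_x(\alpha,\beta):=\frac{\int_0^x t^{\alpha-1}(1-t)^{\beta-1}\,\mathrm{d}t}{\int_0^1 t^{\alpha-1}(1-t)^{\beta-1}\,\mathrm{d}t}$$ ($I_x$ is the regularized Beta function, for $\alpha,\beta>0$, $0\le x\le 1$). For integer $n$, $D(n;w,p)=\sum_{k=w}^n\binom{n}{k}p^k(1-p)^{n-k}$. A vector $\vec n$ is feasible if it satisfies all the constraints. *)

theory Defs
  imports "HOL-Analysis.Analysis"
begin

text \<open>The regularized Beta function. With \<open>powr\<close> we have \<open>0 powr 0 = 0\<close>, so for
  \<open>\<alpha> = 1\<close> or \<open>\<beta> = 1\<close> the integrand differs from the conventional one at an endpoint only;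
  this does not affect the integrals.\<close>

definition reg_Beta :: "real \<Rightarrow> real \<Rightarrow> real \<Rightarrow> real" where
  "reg_Beta x \<alpha> \<beta> =
     integral {0..x} (\<lambda>t. t powr (\<alpha> - 1) * (1 - t) powr (\<beta> - 1)) /
     integral {0..1} (\<lambda>t. t powr (\<alpha> - 1) * (1 - t) powr (\<beta> - 1))"

definition D :: "real \<Rightarrow> nat \<Rightarrow> real \<Rightarrow> real" where
  "D n w p = reg_Beta p (real w) (n - real w + 1)"

definition feasible_set :: "('b::finite \<Rightarrow> nat) \<Rightarrow> ('b \<Rightarrow> real) \<Rightarrow> real \<Rightarrow> (real ^ 'b) set" where
  "feasible_set w p \<epsilon> =
     {n. (\<forall>i. n $ i \<ge> real (w i)) \<and> (\<Prod>i\<in>UNIV. D (n $ i) (w i) (p i)) \<ge> \<epsilon>}"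

definition local_minimizer :: "('a::topological_space \<Rightarrow> real) \<Rightarrow> 'a set \<Rightarrow> 'a \<Rightarrow> bool" where
  "local_minimizer f S x \<longleftrightarrow>
     x \<in> S \<and> (\<exists>U. open U \<and> x \<in> U \<and> (\<forall>y\<in>S \<inter> U. f x \<le> f y))"

end

theory Submission
  imports Defs
begin

text \<open>The map \<open>n \<mapsto> D n w p\<close> is log-concave, so the feasible set is convex, and a local minimizer
  of a linear function on a convex set is global.

  For log-concavity put \<open>B s p = \<integral>\<^sub>0\<^sup>p t\<^sup>m (1 - t)\<^sup>s dt\<close>, so that \<open>D n w p = B s p / B s 1\<close> with
  \<open>m = w - 1\<close> and \<open>s = n - w\<close>. The quotient \<open>(\<partial>B/\<partial>p) / B\<close> is convex in \<open>s\<close>. Hence, for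
  \<open>z = u x + v y\<close> a convex combination, \<open>ln (B z p) - u ln (B x p) - v ln (B y p)\<close> decreases
  in \<open>p\<close>, and its value at \<open>p\<close> is at least its value at \<open>1\<close>; this is the concavity of
  \<open>ln (B s p / B s 1)\<close> in \<open>s\<close>. The convexity of the quotient amounts to an inequality
  \<open>J\<^sub>0 J\<^sub>2 \<le> 2 J\<^sub>1\<^sup>2\<close> between log-moments.\<close>

section \<open>Primitives with respect to a positive weight, and log-concavity\<close>

lemma weighted_primitive_pos:
  fixes F f v :: "real \<Rightarrow> real"
  assumes cont: "continuous_on {a..<b} F" and "F a = 0"
    and deriv: "\<And>x. x \<in> {a<..<b} \<Longrightarrow> (F has_real_derivative f x * v x) (at x)"
    and pos: "\<And>x. x \<in> {a<..<b} \<Longrightarrow> 0 < f x" "\<And>x. x \<in> {a<..<b} \<Longrightarrow> 0 < v x"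
    and x: "x \<in> {a<..<b}"
  shows "0 < F x"
proof -
  have "F a < F x"
  proof (rule DERIV_pos_imp_increasing_open[of a x F])
    show "\<exists>d. (F has_real_derivative d) (at y) \<and> 0 < d" if "a < y" "y < x" for y
      using deriv[of y] pos[of y] that x by auto
    show "continuous_on {a..x} F"
      by (rule continuous_on_subset[OF cont]) (use x in auto)
  qed (use x in auto)
  then show ?thesis using \<open>F a = 0\<close> by simp
qed

text \<open>In the variable \<open>T\<close> with \<open>dT = v dx\<close>, \<open>F\<close> is a
  primitive of \<open>f\<close> and \<open>g\<close> is the logarithmic derivative of
  \<open>f\<close>. Freezing the value \<open>g x\<close> at the right end makes
  \<open>f - g x * F\<close> nondecreasing on \<open>{a..x}\<close>, and it starts at
  \<open>f a\<close>.\<close>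

lemma weighted_primitive_log_derivative_le:
  fixes F f g v :: "real \<Rightarrow> real"
  assumes cont: "continuous_on {a..<b} F" "continuous_on {a..<b} f"
    and init: "F a = 0" "0 \<le> f a"
    and dF: "\<And>x. x \<in> {a<..<b} \<Longrightarrow> (F has_real_derivative f x * v x) (at x)"
    and df: "\<And>x. x \<in> {a<..<b} \<Longrightarrow> (f has_real_derivative g x * f x * v x) (at x)"
    and pos: "\<And>x. x \<in> {a<..<b} \<Longrightarrow> 0 < f x" "\<And>x. x \<in> {a<..<b} \<Longrightarrow> 0 < v x"
    and g: "antimono_on {a<..<b} g"
    and x: "x \<in> {a<..<b}"
  shows "g x * F x \<le> f x"
proof -
  have "f a - g x * F a \<le> f x - g x * F x"
  proof (rule DERIV_nonneg_imp_increasing_open[of a x "\<lambda>y. f y - g x * F y"])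
    show "\<exists>d. ((\<lambda>y. f y - g x * F y) has_real_derivative d) (at y) \<and> 0 \<le> d"
      if "a < y" "y < x" for y
    proof (intro exI conjI)
      have y: "y \<in> {a<..<b}" using that x by auto
      show "((\<lambda>y. f y - g x * F y) has_real_derivative g y * f y * v y - g x * (f y * v y)) (at y)"
        by (intro DERIV_diff DERIV_cmult dF df y)
      have "g x \<le> g y" using monotone_onD[OF g y x] that by simp
      then have "0 \<le> (g y - g x) * (f y * v y)"
        using pos(1)[OF y] pos(2)[OF y] by simp
      then show "0 \<le> g y * f y * v y - g x * (f y * v y)"
        by (simp add: algebra_simps)
    qed
    show "continuous_on {a..x} (\<lambda>y. f y - g x * F y)"
      by (intro continuous_intros continuous_on_subset[OF cont(1)] continuous_on_subset[OF cont(2)])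
        (use x in auto)
  qed (use x in auto)
  then show ?thesis using init by simp
qed

text \<open>In the variable \<open>T\<close> with \<open>dT = v dx\<close>, this says that a
  primitive inherits log-concavity: the derivative of \<open>f / F\<close> has the sign of
  \<open>g * F - f\<close>. The conclusion has the shape of the hypothesis on \<open>g\<close>, so
  the lemma can be iterated.\<close>

lemma weighted_primitive_log_concave:
  fixes F f g v :: "real \<Rightarrow> real"
  assumes cont: "continuous_on {a..<b} F" "continuous_on {a..<b} f"
    and init: "F a = 0" "0 \<le> f a"
    and dF: "\<And>x. x \<in> {a<..<b} \<Longrightarrow> (F has_real_derivative f x * v x) (at x)"
    and df: "\<And>x. x \<in> {a<..<b} \<Longrightarrow> (f has_real_derivative g x * f x * v x) (at x)"
    and pos: "\<And>x. x \<in> {a<..<b} \<Longrightarrow> 0 < f x" "\<And>x. x \<in> {a<..<b} \<Longrightarrow> 0 < v x"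
    and g: "antimono_on {a<..<b} g"
  shows "antimono_on {a<..<b} (\<lambda>x. f x / F x)"
proof (rule monotone_onI)
  fix x y assume x: "x \<in> {a<..<b}" and y: "y \<in> {a<..<b}" and "x \<le> y"
  have Fpos: "0 < F z" if "z \<in> {a<..<b}" for z
    using weighted_primitive_pos[OF cont(1) init(1) dF pos that] .
  show "f y / F y \<le> f x / F x"
  proof (rule DERIV_nonpos_imp_nonincreasing[OF \<open>x \<le> y\<close>])
    fix z assume "x \<le> z" "z \<le> y"
    then have z: "z \<in> {a<..<b}" using x y by auto
    have "((\<lambda>z. f z / F z) has_real_derivative
        (g z * f z * v z * F z - f z * (f z * v z)) / (F z * F z)) (at z)"
      using Fpos[OF z] by (intro derivative_intros dF df z) simp
    moreover have "g z * f z * v z * F z - f z * (f z * v z) = (f z * v z) * (g z * F z - f z)"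
      by (simp add: algebra_simps)
    moreover have "(f z * v z) * (g z * F z - f z) \<le> 0"
      using weighted_primitive_log_derivative_le[OF cont init dF df pos g z] pos(1)[OF z] pos(2)[OF z]
      by (simp add: mult_nonneg_nonpos)
    ultimately show "\<exists>d. ((\<lambda>z. f z / F z) has_real_derivative d) (at z) \<and> d \<le> 0"
      using divide_nonpos_nonneg by fastforce
  qed
qed

section \<open>Incomplete Beta integrals with logarithmic factors\<close>

text \<open>For \<open>p < 1\<close> this is the \<open>k\<close>-th derivative in \<open>s\<close>
  of the incomplete Beta integral. The natural power \<open>t ^ m\<close> is 1 at
  \<open>t = 0\<close> when \<open>m = 0\<close>, which keeps the integrand continuous
  there.\<close>

definition log_Beta_integral :: "nat \<Rightarrow> nat \<Rightarrow> real \<Rightarrow> real \<Rightarrow> real" where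
  "log_Beta_integral k m s p = integral {0..p} (\<lambda>t. ln (1 - t) ^ k * t ^ m * (1 - t) powr s)"

lemma continuous_on_log_Beta_integrand:
  fixes p :: real
  assumes "p < 1"
  shows "continuous_on {0..p} (\<lambda>t. ln (1 - t) ^ k * t ^ m * (1 - t) powr s)"
  using assms by (intro continuous_intros) auto

lemma log_Beta_integral_0 [simp]: "log_Beta_integral k m s 0 = 0"
  by (simp add: log_Beta_integral_def)

lemma has_real_derivative_log_Beta_integral_endpoint:
  assumes "p \<in> {0<..<1}"
  shows "(log_Beta_integral k m s has_real_derivative ln (1 - p) ^ k * p ^ m * (1 - p) powr s) (at p)"
proof -
  obtain q where q: "p < q" "q < 1" using assms dense by auto
  have "((\<lambda>x. integral {0..x} (\<lambda>t. ln (1 - t) ^ k * t ^ m * (1 - t) powr s)) has_real_derivative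
      ln (1 - p) ^ k * p ^ m * (1 - p) powr s) (at p within {0..q})"
    by (rule integral_has_real_derivative[OF continuous_on_log_Beta_integrand]) (use assms q in auto)
  moreover have "at p within {0..q} = at p"
    by (rule at_within_interior) (use assms q in auto)
  ultimately show ?thesis unfolding log_Beta_integral_def[abs_def] by simp
qed

lemma continuous_on_log_Beta_integral: "continuous_on {0..<1} (log_Beta_integral k m s)"
proof (rule continuous_on_eq_continuous_within[THEN iffD2], intro ballI)
  fix p :: real assume p: "p \<in> {0..<1}"
  then obtain q where q: "p < q" "q < 1" using dense by auto
  have "continuous_on {0..q} (log_Beta_integral k m s)"
    unfolding log_Beta_integral_def
    by (intro indefinite_integral_continuous_1 integrable_continuous_real
        continuous_on_log_Beta_integrand q)
  then have "continuous (at p within {0..q}) (log_Beta_integral k m s)"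
    using p q by (auto simp: continuous_on_eq_continuous_within)
  moreover have "at p within {0..<1} = at p within {0..q}"
    by (rule at_within_nhd[where S = "{..<q}"]) (use p q in auto)
  ultimately show "continuous (at p within {0..<1}) (log_Beta_integral k m s)"
    by simp
qed

lemma has_real_derivative_log_Beta_integral_exponent:
  assumes "p < 1"
  shows "((\<lambda>s. log_Beta_integral k m s p) has_real_derivative log_Beta_integral (Suc k) m s p) (at s)"
proof -
  have "((\<lambda>s. integral (cbox 0 p) (\<lambda>t. ln (1 - t) ^ k * t ^ m * (1 - t) powr s)) has_field_derivative
      integral (cbox 0 p) (\<lambda>t. ln (1 - t) ^ Suc k * t ^ m * (1 - t) powr s)) (at s within UNIV)"
  proof (rule leibniz_rule_field_derivative)
    show "((\<lambda>s. ln (1 - t) ^ k * t ^ m * (1 - t) powr s) has_real_derivative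
        ln (1 - t) ^ Suc k * t ^ m * (1 - t) powr s) (at s within UNIV)"
      if "t \<in> cbox 0 p" for s t
      using that assms by (auto intro!: derivative_eq_intros)
    show "(\<lambda>t. ln (1 - t) ^ k * t ^ m * (1 - t) powr s) integrable_on cbox 0 p" for s
      using integrable_continuous_real[OF continuous_on_log_Beta_integrand[OF assms]] by simp
    show "continuous_on (UNIV \<times> cbox 0 p) (\<lambda>(s, t). ln (1 - t) ^ Suc k * t ^ m * (1 - t) powr s)"
      unfolding case_prod_beta by (intro continuous_intros) (use assms in auto)
  qed auto
  then show ?thesis by (simp add: log_Beta_integral_def)
qed

text \<open>With \<open>ln (1 - t)\<close> recentred at \<open>ln (1 - p)\<close>, the first two log-moments arise from the
  zeroth one by repeatedly integrating against \<open>dt / (1 - t)\<close>, which preserves log-concavity.\<close>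

lemma
  fixes m :: nat and s :: real
  defines "J0 \<equiv> log_Beta_integral 0 m s"
    and "J1 \<equiv> \<lambda>p. log_Beta_integral 1 m s p - ln (1 - p) * log_Beta_integral 0 m s p"
    and "J2 \<equiv> \<lambda>p. log_Beta_integral 2 m s p - 2 * ln (1 - p) * log_Beta_integral 1 m s p
      + ln (1 - p) ^ 2 * log_Beta_integral 0 m s p"
  assumes p: "p \<in> {0<..<1}"
  shows log_Beta_integral_0_pos: "0 < J0 p"
    and log_Beta_integral_moments_le: "J0 p * J2 p \<le> 2 * J1 p ^ 2"
proof -
  \<comment> \<open>The exponent \<open>s + 1\<close> compensates the weight \<open>v\<close>, so
    that \<open>j * v\<close> is the integrand of \<open>J0\<close>; \<open>g\<close> is the
    logarithmic derivative of \<open>j\<close> with respect to that weight.\<close>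
  define j v g where "j = (\<lambda>p. p ^ m * (1 - p) powr (s + 1))"
    and "v = (\<lambda>p::real. 1 / (1 - p))"
    and "g = (\<lambda>p. real m * (1 / p - 1) - (s + 1))"
  note defs = J0_def J1_def J2_def j_def v_def
  note dL = has_real_derivative_log_Beta_integral_endpoint
  have cont: "continuous_on {0..<1} J0" "continuous_on {0..<1} J1" "continuous_on {0..<1} (\<lambda>p. J2 p / 2)"
      "continuous_on {0..<1} j"
    unfolding defs
    by (intro continuous_intros continuous_on_log_Beta_integral; force)+
  have init: "J0 0 = 0" "J1 0 = 0" "J2 0 / 2 = 0" "0 \<le> j 0"
    unfolding defs by simp_all
  have powr: "(1 - x) powr (s + 1) = (1 - x) powr s * (1 - x)" if "x \<in> {0<..<1}" for x
    using that by (simp add: powr_add)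
  have dJ0: "(J0 has_real_derivative j x * v x) (at x)" if "x \<in> {0<..<1}" for x
    unfolding defs by (rule DERIV_cong[OF dL[OF that]]) (use that powr in simp)
  have dln: "((\<lambda>x. ln (1 - x)) has_real_derivative - v x) (at x)" if "x \<in> {0<..<1}" for x
    unfolding v_def using that by (auto intro!: derivative_eq_intros)
  \<comment> \<open>Recentring cancels the endpoint terms, leaving only the derivative of
    \<open>ln (1 - x)\<close>. For \<open>J2\<close> the same computation gives
    \<open>2 * J1 x * v x\<close>, hence the halving below.\<close>
  have dJ1: "(J1 has_real_derivative J0 x * v x) (at x)" if "x \<in> {0<..<1}" for x
    unfolding J0_def J1_def
    by (rule DERIV_cong[OF DERIV_diff[OF dL DERIV_mult[OF dln dL]]]) (use that in auto)
  have dJ2: "((\<lambda>p. J2 p / 2) has_real_derivative J1 x * v x) (at x)" if "x \<in> {0<..<1}" for x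
    unfolding J1_def J2_def
    by (rule DERIV_cong[OF DERIV_cdivide[OF DERIV_add[OF
            DERIV_diff[OF dL DERIV_mult[OF DERIV_cmult[OF dln] dL]]
            DERIV_mult[OF DERIV_power[OF dln] dL]]]])
      (use that in \<open>auto simp: algebra_simps power2_eq_square diff_divide_distrib\<close>)
  have dj: "(j has_real_derivative g x * j x * v x) (at x)" if "x \<in> {0<..<1}" for x
  proof -
    have "(j has_real_derivative real m * x ^ (m - 1) * (1 - x) powr (s + 1)
        - x ^ m * ((s + 1) * (1 - x) powr s)) (at x)"
      unfolding j_def using that
      by (auto intro!: derivative_eq_intros simp: algebra_simps)
    moreover have "real m * x ^ (m - 1) * (1 - x) powr (s + 1) - x ^ m * ((s + 1) * (1 - x) powr s)
        = g x * j x * v x"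
    proof -
      \<comment> \<open>For \<open>m = 0\<close> the truncated \<open>m - 1\<close> is harmless,
        since both sides vanish.\<close>
      have m: "real m * x ^ (m - 1) = real m * x ^ m / x"
        using that by (cases m) auto
      show ?thesis
        unfolding m g_def j_def v_def powr[OF that] using that by (simp add: field_simps)
    qed
    ultimately show ?thesis by simp
  qed
  have g: "antimono_on {0<..<1} g"
    by (auto intro!: monotone_onI mult_right_mono simp: g_def field_simps)
  have vpos: "0 < v x" and jpos: "0 < j x" if "x \<in> {0<..<1}" for x
    using that by (auto simp: v_def j_def)
  have J0pos: "0 < J0 x" if "x \<in> {0<..<1}" for x
    using weighted_primitive_pos[OF cont(1) init(1) dJ0 jpos vpos that] .
  have J1pos: "0 < J1 x" if "x \<in> {0<..<1}" for x
    using weighted_primitive_pos[OF cont(2) init(2) dJ1 J0pos vpos that] .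
  \<comment> \<open>Log-concavity passes from \<open>j\<close> to \<open>J0\<close> and then to
    \<open>J1\<close>. For \<open>J2 / 2\<close> the bound on the logarithmic derivative suffices;
    the halving yields the factor 2 in the inequality.\<close>
  have a1: "antimono_on {0<..<1} (\<lambda>x. j x / J0 x)"
    by (rule weighted_primitive_log_concave[OF cont(1) cont(4) init(1,4) dJ0 dj jpos vpos g])
  have a2: "antimono_on {0<..<1} (\<lambda>x. J0 x / J1 x)"
    by (rule weighted_primitive_log_concave[OF cont(2) cont(1) init(2) _ dJ1 _ J0pos vpos a1])
      (use init dJ0 J0pos in \<open>auto simp: less_imp_neq[symmetric]\<close>)
  have "J0 p / J1 p * (J2 p / 2) \<le> J1 p"
    by (rule weighted_primitive_log_derivative_le[OF cont(3) cont(2) init(3) _ dJ2 _ J1pos vpos a2 p])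
      (use init dJ1 J1pos in \<open>auto simp: less_imp_neq[symmetric]\<close>)
  then show "J0 p * J2 p \<le> 2 * J1 p ^ 2"
    using J1pos[OF p] by (simp add: field_simps power2_eq_square)
  show "0 < J0 p" by (rule J0pos[OF p])
qed

section \<open>Convexity in the exponent\<close>

text \<open>The second derivative in \<open>s\<close> is a nonnegative multiple of
  \<open>2 * J1^2 - J0 * J2\<close>, with the recentred log-moments at \<open>p\<close>.\<close>

lemma convex_on_Beta_reversed_hazard:
  assumes p: "p \<in> {0<..<1}"
  shows "convex_on UNIV (\<lambda>s. p ^ m * (1 - p) powr s / log_Beta_integral 0 m s p)"
proof -
  define l where "l = ln (1 - p)"
  define L where "L k s = log_Beta_integral k m s p" for k s
  define r where "r s = p ^ m * (1 - p) powr s / L 0 s" for s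
  have L0: "0 < L 0 s" for s
    unfolding L_def by (rule log_Beta_integral_0_pos[OF p])
  have dL: "(L k has_real_derivative L (Suc k) s) (at s)" for k s
    unfolding L_def by (rule has_real_derivative_log_Beta_integral_exponent) (use p in simp)
  have dr: "(r has_real_derivative r s * (l - L 1 s / L 0 s)) (at s)" for s
    unfolding r_def using p L0[of s]
    by (auto intro!: derivative_eq_intros dL simp: l_def field_simps)
  have dr': "((\<lambda>s. r s * (l - L 1 s / L 0 s)) has_real_derivative
      r s * (l - L 1 s / L 0 s)\<^sup>2 - r s * ((L 2 s * L 0 s - L 1 s ^ 2) / L 0 s ^ 2)) (at s)" for s
    using L0[of s]
    by (auto intro!: derivative_eq_intros dr dL simp: field_simps power2_eq_square numeral_2_eq_2)
  have "convex_on UNIV r"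
  proof (rule f''_ge0_imp_convex[OF _ dr dr'])
    fix s
    have "r s * (l - L 1 s / L 0 s)\<^sup>2 - r s * ((L 2 s * L 0 s - L 1 s ^ 2) / L 0 s ^ 2) =
        r s / L 0 s ^ 2 * (2 * (L 1 s - l * L 0 s)\<^sup>2 - L 0 s * (L 2 s - 2 * l * L 1 s + l\<^sup>2 * L 0 s))"
      using L0[of s] by (simp add: field_simps power2_eq_square)
    also have "\<dots> \<ge> 0"
      using log_Beta_integral_moments_le[OF p, of m s] L0[of s] p
      by (intro mult_nonneg_nonneg) (auto simp: r_def L_def l_def)
    finally show "0 \<le> r s * (l - L 1 s / L 0 s)\<^sup>2 - r s * ((L 2 s * L 0 s - L 1 s ^ 2) / L 0 s ^ 2)" .
  qed simp
  then show ?thesis by (simp add: r_def[abs_def] L_def)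
qed

section \<open>The endpoint 1 and log-concavity of the regularized integral\<close>

lemma has_integral_log_Beta_0:
  assumes "-1 < s"
  shows "((\<lambda>t. t powr real m * (1 - t) powr s) has_integral Beta (real m + 1) (s + 1)) {0..1}"
  using has_integral_Beta_real[of "real m + 1" "s + 1"] assms by simp

text \<open>The integrands can differ only at \<open>t = 0\<close>, where
  \<open>0 powr 0 = 0\<close> but \<open>0 ^ 0 = 1\<close>.\<close>

lemma integral_powr_eq_log_Beta_integral:
  "integral {0..p} (\<lambda>t. t powr real m * (1 - t) powr s) = log_Beta_integral 0 m s p"
  unfolding log_Beta_integral_def
  by (rule integral_spike[where S = "{0}"]) (auto simp: powr_realpow)

text \<open>For \<open>-1 < s < 0\<close> the integrand is unbounded near 1, so continuity up to 1
  rests on its integrability, which the complete Beta integral supplies.\<close>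

lemma continuous_on_log_Beta_integral_0:
  assumes "-1 < s"
  shows "continuous_on {0..1} (log_Beta_integral 0 m s)"
proof -
  have "continuous_on {0..1} (\<lambda>p. integral {0..p} (\<lambda>t. t powr real m * (1 - t) powr s))"
    by (rule indefinite_integral_continuous_1)
      (use has_integral_log_Beta_0[OF assms] in blast)
  then show ?thesis by (simp add: integral_powr_eq_log_Beta_integral)
qed

lemma log_Beta_integral_0_at_1_pos:
  assumes "-1 < s"
  shows "0 < log_Beta_integral 0 m s 1"
proof -
  have "log_Beta_integral 0 m s 1 = Beta (real m + 1) (s + 1)"
    using integral_unique[OF has_integral_log_Beta_0[OF assms]]
    by (simp add: integral_powr_eq_log_Beta_integral)
  also have "\<dots> > 0" using assms by (simp add: Beta_def Gamma_real_pos)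
  finally show ?thesis .
qed

lemma concave_on_ln_Beta_ratio:
  assumes p: "p \<in> {0<..<1}"
  shows "concave_on {-1<..} (\<lambda>s. ln (log_Beta_integral 0 m s p / log_Beta_integral 0 m s 1))"
  unfolding concave_on_iff
proof (intro conjI ballI allI impI)
  show "convex ({-1<..} :: real set)" by (rule convex_real_interval)
  fix x y u v :: real
  assume xy: "x \<in> {-1<..}" "y \<in> {-1<..}" and uv: "0 \<le> u" "0 \<le> v" "u + v = 1"
  define z where "z = u * x + v * y"
  have "z \<in> {-1<..}"
    using convexD[OF convex_real_interval(3)[of "-1"] xy uv] by (simp add: z_def)
  define L where "L s q = log_Beta_integral 0 m s q" for s q
  have Lpos: "0 < L s q" if "-1 < s" "0 < q" "q \<le> 1" for s q
    using log_Beta_integral_0_pos[of q m s] log_Beta_integral_0_at_1_pos[of s m] that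
    by (cases "q = 1") (auto simp: L_def)
  define G where "G q = ln (L z q) - u * ln (L x q) - v * ln (L y q)" for q
  \<comment> \<open>As the logarithm of each ratio is a difference, \<open>G 1 \<le> G p\<close> is
    exactly the concavity inequality. Derivatives are needed only inside the interval; at 1
    continuity is enough.\<close>
  have "- G p \<le> - G 1"
  proof (rule DERIV_nonneg_imp_increasing_open[of p 1 "\<lambda>q. - G q"])
    show "\<exists>d. ((\<lambda>q. - G q) has_real_derivative d) (at q) \<and> 0 \<le> d" if "p < q" "q < 1" for q
    proof (intro exI conjI)
      have q: "q \<in> {0<..<1}" using p that by auto
      have "((\<lambda>q. ln (L s q)) has_real_derivative q ^ m * (1 - q) powr s / L s q) (at q)"
        if "-1 < s" for s
        using that q Lpos[of s q] has_real_derivative_log_Beta_integral_endpoint[OF q, of 0 m s]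
        by (auto intro!: derivative_eq_intros simp: L_def)
      then show "((\<lambda>q. - G q) has_real_derivative
          - (q ^ m * (1 - q) powr z / L z q - u * (q ^ m * (1 - q) powr x / L x q)
            - v * (q ^ m * (1 - q) powr y / L y q))) (at q)"
        unfolding G_def using xy \<open>z \<in> _\<close> by (intro derivative_intros DERIV_cmult) auto
      have "q ^ m * (1 - q) powr z / L z q \<le>
          u * (q ^ m * (1 - q) powr x / L x q) + v * (q ^ m * (1 - q) powr y / L y q)"
        using convex_on_Beta_reversed_hazard[OF q, of m] uv
        unfolding convex_on_def z_def L_def real_scaleR_def by blast
      then show "0 \<le> - (q ^ m * (1 - q) powr z / L z q - u * (q ^ m * (1 - q) powr x / L x q)
            - v * (q ^ m * (1 - q) powr y / L y q))"
        by linarith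
    qed
    have "continuous_on {p..1} (\<lambda>q. ln (L s q))" if "-1 < s" for s
      using continuous_on_subset[OF continuous_on_log_Beta_integral_0[OF that, of m], of "{p..1}"] p
        Lpos[OF that] unfolding L_def
      by (intro continuous_on_ln) (auto simp: less_imp_neq[symmetric])
    then show "continuous_on {p..1} (\<lambda>q. - G q)"
      unfolding G_def using xy \<open>z \<in> _\<close>
      by (intro continuous_on_minus continuous_on_diff continuous_on_mult_left) auto
  qed (use p in auto)
  moreover have "ln (L s p / L s 1) = ln (L s p) - ln (L s 1)" if "-1 < s" for s
    using Lpos[OF that, of p] Lpos[OF that, of 1] p by (simp add: ln_div)
  then have "ln (L x p / L x 1) = ln (L x p) - ln (L x 1)" "ln (L y p / L y 1) = ln (L y p) - ln (L y 1)"
      "ln (L z p / L z 1) = ln (L z p) - ln (L z 1)"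
    using xy \<open>z \<in> _\<close> by auto
  ultimately show "u * ln (log_Beta_integral 0 m x p / log_Beta_integral 0 m x 1)
      + v * ln (log_Beta_integral 0 m y p / log_Beta_integral 0 m y 1)
      \<le> ln (log_Beta_integral 0 m (u *\<^sub>R x + v *\<^sub>R y) p / log_Beta_integral 0 m (u *\<^sub>R x + v *\<^sub>R y) 1)"
    by (simp add: G_def right_diff_distrib flip: L_def z_def)
qed

section \<open>Log-concavity of \<open>D\<close> and convexity of the feasible set\<close>

lemma D_eq_log_Beta_integral:
  assumes "0 < w"
  shows "D n w p = log_Beta_integral 0 (w - 1) (n - real w) p / log_Beta_integral 0 (w - 1) (n - real w) 1"
  using assms unfolding D_def reg_Beta_def
  by (simp flip: integral_powr_eq_log_Beta_integral add: of_nat_diff)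

lemma D_pos:
  assumes "0 < w" "0 < p" "p < 1" "real w \<le> n"
  shows "0 < D n w p"
  using assms log_Beta_integral_0_pos[of p "w - 1" "n - real w"]
    log_Beta_integral_0_at_1_pos[of "n - real w" "w - 1"]
  by (simp add: D_eq_log_Beta_integral)

text \<open>The shift \<open>s = n - w\<close> is affine and sends the domain into
  \<open>{-1<..}\<close>, so the concavity in \<open>s\<close> carries over.\<close>

lemma concave_on_ln_D:
  assumes "0 < w" "0 < p" "p < 1"
  shows "concave_on {real w..} (\<lambda>n. ln (D n w p))"
  unfolding concave_on_iff
proof (intro conjI ballI allI impI)
  show "convex {real w..}" by (rule convex_real_interval)
  fix x y u v :: real
  assume xy: "x \<in> {real w..}" "y \<in> {real w..}" and uv: "0 \<le> u" "0 \<le> v" "u + v = 1"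
  have eq: "u * x + v * y - real w = u * (x - real w) + v * (y - real w)"
    using uv(3) by (simp add: algebra_simps flip: distrib_right)
  show "u * ln (D x w p) + v * ln (D y w p) \<le> ln (D (u *\<^sub>R x + v *\<^sub>R y) w p)"
    using concave_on_ln_Beta_ratio[of p "w - 1"] assms xy uv
    unfolding concave_on_iff real_scaleR_def D_eq_log_Beta_integral[OF assms(1)] eq by simp
qed

text \<open>The logarithm turns the product constraint into a lower bound on a sum of concave
  functions of single coordinates.\<close>

lemma convex_feasible_set:
  fixes w :: "'b::finite \<Rightarrow> nat"
  assumes w: "\<And>i. 0 < w i" and p: "\<And>i. 0 < p i \<and> p i < 1" and \<epsilon>: "0 < \<epsilon>"
  shows "convex (feasible_set w p \<epsilon>)"
proof (rule convexI)
  fix x y :: "real ^ 'b" and u v :: real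
  assume x: "x \<in> feasible_set w p \<epsilon>" and y: "y \<in> feasible_set w p \<epsilon>"
    and uv: "0 \<le> u" "0 \<le> v" "u + v = 1"
  define z where "z = u *\<^sub>R x + v *\<^sub>R y"
  define P where "P n = (\<Prod>i\<in>UNIV. D (n $ i) (w i) (p i))" for n :: "real ^ 'b"
  have ge: "real (w i) \<le> x $ i" "real (w i) \<le> y $ i" and P: "\<epsilon> \<le> P x" "\<epsilon> \<le> P y" for i
    using x y by (auto simp: feasible_set_def P_def)
  have zi: "real (w i) \<le> z $ i" for i
    using convexD[OF convex_real_interval(1)[of "real (w i)"], of "x $ i" "y $ i" u v] ge uv
    by (simp add: z_def)
  have Dpos: "0 < D (n $ i) (w i) (p i)" if "\<And>i. real (w i) \<le> n $ i" for n :: "real ^ 'b" and i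
    using D_pos w p that by blast
  have lnP: "ln (P n) = (\<Sum>i\<in>UNIV. ln (D (n $ i) (w i) (p i)))"
    if "\<And>i. real (w i) \<le> n $ i" for n :: "real ^ 'b"
    unfolding P_def by (rule ln_prod) (use Dpos[OF that] in \<open>auto simp: less_le\<close>)
  have "ln \<epsilon> = u * ln \<epsilon> + v * ln \<epsilon>"
    using uv(3) by (simp flip: distrib_right)
  also have "\<dots> \<le> u * ln (P x) + v * ln (P y)"
    using P \<epsilon> uv by (intro add_mono mult_left_mono) auto
  also have "\<dots> = (\<Sum>i\<in>UNIV. u * ln (D (x $ i) (w i) (p i)) + v * ln (D (y $ i) (w i) (p i)))"
    using ge by (simp add: lnP sum.distrib sum_distrib_left)
  also have "\<dots> \<le> (\<Sum>i\<in>UNIV. ln (D (z $ i) (w i) (p i)))"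
    using concave_on_ln_D[OF w] p ge uv
    by (intro sum_mono) (auto simp: concave_on_iff z_def)
  also have "\<dots> = ln (P z)" by (simp add: lnP zi)
  finally have "\<epsilon> \<le> P z"
    using \<epsilon> Dpos[OF zi] by (subst (asm) ln_le_cancel_iff) (auto simp: P_def prod_pos)
  then show "u *\<^sub>R x + v *\<^sub>R y \<in> feasible_set w p \<epsilon>"
    using zi by (simp add: feasible_set_def P_def z_def)
qed

section \<open>Linear objectives on convex sets\<close>

text \<open>A short step from \<open>x\<close> towards \<open>y\<close> stays in \<open>S\<close>
  and in the neighbourhood \<open>U\<close>; by linearity the comparison there rescales to the one
  at \<open>y\<close>.\<close>

lemma local_minimizer_linear_imp_global:
  fixes c :: "'a::real_inner"
  assumes S: "convex S" and loc: "local_minimizer (\<lambda>n. c \<bullet> n) S x" and y: "y \<in> S"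
  shows "c \<bullet> x \<le> c \<bullet> y"
proof -
  obtain U where x: "x \<in> S" and U: "open U" "x \<in> U" and min: "\<And>z. z \<in> S \<inter> U \<Longrightarrow> c \<bullet> x \<le> c \<bullet> z"
    using loc by (auto simp: local_minimizer_def)
  have "((\<lambda>t::real. (1 - t) *\<^sub>R x + t *\<^sub>R y) \<longlongrightarrow> (1 - 0) *\<^sub>R x + 0 *\<^sub>R y) (at_right 0)"
    by (intro tendsto_intros)
  then have "\<forall>\<^sub>F t in at_right (0::real). (1 - t) *\<^sub>R x + t *\<^sub>R y \<in> U"
    using U by (intro topological_tendstoD) auto
  moreover have "\<forall>\<^sub>F t in at_right (0::real). t \<in> {0<..<1}"
    by (rule eventually_at_right_real) simp
  ultimately have "\<forall>\<^sub>F t in at_right (0::real). (1 - t) *\<^sub>R x + t *\<^sub>R y \<in> U \<and> t \<in> {0<..<1}"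
    by (rule eventually_conj)
  then obtain t :: real where t: "(1 - t) *\<^sub>R x + t *\<^sub>R y \<in> U" "0 < t" "t < 1"
    using eventually_happens'[OF trivial_limit_at_right_real] by fastforce
  then have "c \<bullet> x \<le> c \<bullet> ((1 - t) *\<^sub>R x + t *\<^sub>R y)"
    using min convexD_alt[OF S x y, of t] by simp
  then have "t * (c \<bullet> x) \<le> t * (c \<bullet> y)"
    by (simp add: inner_right_distrib algebra_simps)
  then show ?thesis using t by simp
qed

theorem proposition6p1:
  fixes w :: "'b::finite \<Rightarrow> nat"
    and p :: "'b \<Rightarrow> real"
    and c nstar :: "real ^ 'b"
    and \<epsilon> :: real
  assumes "\<And>i. w i > 0"
    and "\<And>i. 0 < p i \<and> p i < 1"
    and "\<And>i. c $ i > 0"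
    and "\<epsilon> > 0"
    and "local_minimizer (\<lambda>n. c \<bullet> n) (feasible_set w p \<epsilon>) nstar"
  shows "\<forall>n\<in>feasible_set w p \<epsilon>. c \<bullet> nstar \<le> c \<bullet> n"
  using local_minimizer_linear_imp_global[OF convex_feasible_set assms(5)] assms(1,2,4) by blast

end
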